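(* Suppose that $\mathcal{S}_{\mathbb K}\subset\mathbb{K}_{>0}^n$ is a semialgebraic set defined as $$\mathcal{S}_{\mathbb K}=\{\mathbf{x}\in\mathbb{K}_{>0}^n : \mathbf{P}_1(\mathbf{x})\mathrel{\Box_1}0,\dots,\mathbf{P}_m(\mathbf{x})\mathrel{\Box_m}0\},$$ where $\mathbf{P}_i\in\mathbb{K}[X_1,\dots,X_n]$ are nonzero polynomials and $\Box\in\{\ge,>\}^m$. Let $P_i$ be the formal tropicalization of $\mathbf{P}_i$ for all $i$, and suppose that the polyhedral complex $\mathcal{C}^{\ge}(P_1,\dots,P_m)$ has regular support. Then $$\mathrm{val}(\mathcal{S}_{\mathbb K})=\{x\in\mathbb{R}^n : \forall i,\ P_i^+(x)\ge P_i^-(x)\}.$$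
   Context: $\mathbb{K}$ is the field of formal generalized real Puiseux series: series $\mathbf{x}=\sum_{i\ge 1}c_{\lambda_i}t^{\lambda_i}$ where $(\lambda_i)$ is a strictly decreasing sequence of real numbers that is either finite or unbounded and $c_{\lambda_i}\in\mathbb{R}\setminus\{0\}$, together with the empty series $0$, with the natural addition and multiplication. The leading coefficient is $\mathrm{lc}(\mathbf{x})=c_{\lambda_1}$, $\mathrm{lc}(0)=0$; $\mathbb{K}$ is ordered by $\mathbf{x}\ge\mathbf{y}$ iff $\mathrm{lc}(\mathbf{x}-\mathbf{y})\ge 0$, and is a real closed field. $\mathbb{K}_{>0}$ is the set of positive elements. The valuation is $\mathrm{val}(\mathbf{x})=\lambda_1$, $\mathrm{val}(0)=-\infty$, applied coordinatewise. Formal tropicalization: write $\mathbf{P}=\sum_{\alpha\in\Lambda}\mathbf{a}_\alpha X^\alpha$ with $\Lambda\subset\mathbb{Z}_{\ge0}^n$ finite and $\mathbf{a}_\alpha\neq0$. Its formal tropicalization $P$ is the signed tropical polynomial with exponent set $\Lambda$ whose coefficient at $\alpha$ has sign $\mathrm{sign}(\mathbf{a}_\alpha)$ and modulus $|a_\alpha|=\mathrm{val}(\mathbf{a}_\alpha)$. For $x\in\mathbb{R}^n$, $P^+(x)=\max\{|a_\alpha|+\langle\alpha,x\rangle:\mathbf{a}_\alpha>0\}$ and $P^-(x)=\max\{|a_\alpha|+\langle\alpha,x\rangle:\mathbf{a}_\alpha<0\}$, with $\max\emptyset=-\infty$. For $x\in\mathbb{R}^n$, $\mathrm{Argmax}(P,x)$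 is the set of $\alpha\in\Lambda$ maximizing $|a_\alpha|+\langle\alpha,x\rangle$. $\mathcal{C}(P)$ is the polyhedral complex whose cells are the (possibly empty) sets $\mathrm{cl}\{x\in\mathbb{R}^n:\mathrm{Argmax}(P,x)=L\}$, $L\subset\Lambda$; $\mathcal{C}^{\ge}(P)$ consists of the cells that are empty or for which $L$ contains some $\alpha$ with positive coefficient. $\mathcal{C}^{\ge}(P_1,\dots,P_m)=\{\bigcap_i\mathcal{W}_i:\mathcal{W}_i\in\mathcal{C}^{\ge}(P_i)\}$. The support of a complex is the union of its cells; the support of $\mathcal{C}^{\ge}(P_1,\dots,P_m)$ is $\{x\in\mathbb{R}^n:\forall i,\ P_i^+(x)\ge P_i^-(x)\}$. A set $S\subset\mathbb{R}^n$ is regular if it is closed and $S=\mathrm{cl}(\mathrm{int}(S))$ (Euclidean topology). *)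

theory Defs
  imports "HOL-Analysis.Analysis" "HOL-Library.Poly_Mapping"
begin

section \<open>Formal generalized real Puiseux series\<close>

text \<open>
  A series \<open>\<Sum>i. c\<^sub>i t\<^bsup>\<lambda>\<^sub>i\<^esup>\<close> is encoded by its coefficient function on the exponents. A set
  of reals is the set of terms of a strictly decreasing sequence that is finite or unbounded (below)
  if and only if it has finitely many elements in each half-line \<open>{a..}\<close>; the empty support is the
  zero series.
\<close>

typedef puiseux = "{f :: real \<Rightarrow> real. \<forall>a. finite {l. a \<le> l \<and> f l \<noteq> 0}}"
  morphisms pcoeff Abs_puiseux
  by (rule exI[of _ "\<lambda>_. 0"]) simp

setup_lifting type_definition_puiseux

lemma puiseux_eqI: "(\<And>l. pcoeff x l = pcoeff y l) \<Longrightarrow> x = y"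
  by (simp add: pcoeff_inject[symmetric] fun_eq_iff)

lemma finite_psupp_ge: "finite {l. a \<le> l \<and> pcoeff x l \<noteq> 0}"
  using pcoeff[of x] by blast

lemma psupp_bounded: "\<exists>b. \<forall>l. pcoeff x l \<noteq> 0 \<longrightarrow> l \<le> b"
proof -
  let ?A = "insert 0 {l. 0 \<le> l \<and> pcoeff x l \<noteq> 0}"
  have "finite ?A" using finite_psupp_ge by simp
  then have A: "k \<le> Max ?A" if "k \<in> ?A" for k using that by (rule Max_ge)
  have "l \<le> Max ?A" if "pcoeff x l \<noteq> 0" for l
  proof (cases "0 \<le> l")
    case True
    with that show ?thesis by (intro A) simp
  next
    case False
    then have "l \<le> 0" by simp
    also have "0 \<le> Max ?A" by (rule A) simp
    finally show ?thesis .
  qed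
  then show ?thesis by blast
qed

lemma finite_conv: "finite {m. pcoeff x m \<noteq> 0 \<and> pcoeff y (l - m) \<noteq> 0}"
proof -
  obtain b where b: "\<And>l. pcoeff y l \<noteq> 0 \<Longrightarrow> l \<le> b" using psupp_bounded by blast
  have "{m. pcoeff x m \<noteq> 0 \<and> pcoeff y (l - m) \<noteq> 0} \<subseteq> {m. l - b \<le> m \<and> pcoeff x m \<noteq> 0}"
    using b by force
  then show ?thesis by (rule finite_subset) (rule finite_psupp_ge)
qed

definition pmul :: "puiseux \<Rightarrow> puiseux \<Rightarrow> real \<Rightarrow> real" where
  "pmul x y l = (\<Sum>m | pcoeff x m \<noteq> 0 \<and> pcoeff y (l - m) \<noteq> 0. pcoeff x m * pcoeff y (l - m))"

lemma pmul_eq: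
  assumes "finite A" "\<And>m. pcoeff x m \<noteq> 0 \<Longrightarrow> pcoeff y (l - m) \<noteq> 0 \<Longrightarrow> m \<in> A"
  shows "pmul x y l = (\<Sum>m\<in>A. pcoeff x m * pcoeff y (l - m))"
  unfolding pmul_def by (rule sum.mono_neutral_left) (use assms in auto)

lemma pmul_nonzeroE:
  assumes "pmul x y l \<noteq> 0"
  obtains m where "pcoeff x m \<noteq> 0" "pcoeff y (l - m) \<noteq> 0"
  using assms unfolding pmul_def by (rule sum.not_neutral_contains_not_neutral) (use that in auto)

lemma finite_pmul: "finite {l. a \<le> l \<and> pmul x y l \<noteq> 0}"
proof -
  obtain b where b: "\<And>l. pcoeff x l \<noteq> 0 \<Longrightarrow> l \<le> b" using psupp_bounded by blast
  obtain c where c: "\<And>l. pcoeff y l \<noteq> 0 \<Longrightarrow> l \<le> c" using psupp_bounded by blast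
  let ?A = "{l. a - c \<le> l \<and> pcoeff x l \<noteq> 0}" and ?B = "{l. a - b \<le> l \<and> pcoeff y l \<noteq> 0}"
  have "{l. a \<le> l \<and> pmul x y l \<noteq> 0} \<subseteq> (\<lambda>(m, n). m + n) ` (?A \<times> ?B)"
  proof
    fix l assume l: "l \<in> {l. a \<le> l \<and> pmul x y l \<noteq> 0}"
    then obtain m where m: "pcoeff x m \<noteq> 0" "pcoeff y (l - m) \<noteq> 0"
      by (auto elim: pmul_nonzeroE)
    from b[OF m(1)] c[OF m(2)] l m have "m \<in> ?A" "l - m \<in> ?B" by auto
    moreover have "l = (\<lambda>(m, n). m + n) (m, l - m)" by simp
    ultimately show "l \<in> (\<lambda>(m, n). m + n) ` (?A \<times> ?B)" by blast
  qed
  then show ?thesis by (rule finite_subset) (simp add: finite_psupp_ge)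
qed

lemma finite_nonzero_binop:
  fixes f g :: "real \<Rightarrow> real"
  assumes "\<And>a. finite {l. a \<le> l \<and> f l \<noteq> 0}" "\<And>a. finite {l. a \<le> l \<and> g l \<noteq> 0}" "h 0 0 = (0::real)"
  shows "finite {l. a \<le> l \<and> h (f l) (g l) \<noteq> 0}"
proof (rule finite_subset)
  show "finite ({l. a \<le> l \<and> f l \<noteq> 0} \<union> {l. a \<le> l \<and> g l \<noteq> 0})"
    using assms(1,2)[of a] by (rule finite_UnI)
  show "{l. a \<le> l \<and> h (f l) (g l) \<noteq> 0} \<subseteq> {l. a \<le> l \<and> f l \<noteq> 0} \<union> {l. a \<le> l \<and> g l \<noteq> 0}"
    using assms(3) by auto
qed

text \<open>The exponent of the leading term; unspecified for the zero series.\<close>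
definition lexp :: "puiseux \<Rightarrow> real" where
  "lexp x = (GREATEST l. pcoeff x l \<noteq> 0)"

instantiation puiseux :: comm_ring_1
begin

lift_definition zero_puiseux :: puiseux is "\<lambda>_. 0" by simp

lift_definition one_puiseux :: puiseux is "\<lambda>l. if l = 0 then 1 else 0"
  by (auto intro: finite_subset[of _ "{0}"])

lift_definition plus_puiseux :: "puiseux \<Rightarrow> puiseux \<Rightarrow> puiseux" is "\<lambda>f g l. f l + g l"
  by (rule finite_nonzero_binop[where h = "(+)"]) auto

lift_definition uminus_puiseux :: "puiseux \<Rightarrow> puiseux" is "\<lambda>f l. - f l" by simp

lift_definition minus_puiseux :: "puiseux \<Rightarrow> puiseux \<Rightarrow> puiseux" is "\<lambda>f g l. f l - g l"
  by (rule finite_nonzero_binop[where h = "(-)"]) auto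

definition times_puiseux :: "puiseux \<Rightarrow> puiseux \<Rightarrow> puiseux" where
  "x * y = Abs_puiseux (pmul x y)"

lemma pcoeff_times: "pcoeff (x * y) = pmul x y"
  unfolding times_puiseux_def by (rule Abs_puiseux_inverse) (simp add: finite_pmul)

lemma pmul_commute: "pmul x y l = pmul y x l"
  unfolding pmul_def
  by (rule sum.reindex_bij_witness[of _ "\<lambda>m. l - m" "\<lambda>m. l - m"]) (auto simp: mult.commute)

lemma pmul_assoc: "pmul (x * y) z l = pmul x (y * z) l"
proof -
  obtain a where a: "\<And>l. pcoeff x l \<noteq> 0 \<Longrightarrow> l \<le> a" using psupp_bounded by blast
  obtain b where b: "\<And>l. pcoeff y l \<noteq> 0 \<Longrightarrow> l \<le> b" using psupp_bounded by blast
  obtain c where c: "\<And>l. pcoeff z l \<noteq> 0 \<Longrightarrow> l \<le> c" using psupp_bounded by blast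
  let ?A = "{m. l - b - c \<le> m \<and> pcoeff x m \<noteq> 0}"
  let ?C = "{m. l - a - b \<le> m \<and> pcoeff z m \<noteq> 0}"
  note fin = finite_psupp_ge
  have xy: "n \<le> a + b" if "pmul x y n \<noteq> 0" for n
    using that by (rule pmul_nonzeroE) (auto dest!: a b)
  have yz: "n \<le> b + c" if "pmul y z n \<noteq> 0" for n
    using that by (rule pmul_nonzeroE) (auto dest!: b c)
  have "pmul (x * y) z l = pmul z (x * y) l" by (rule pmul_commute)
  also have "\<dots> = (\<Sum>r\<in>?C. pcoeff z r * pmul x y (l - r))"
    by (subst pmul_eq[OF fin[of "l - a - b" z]]) (auto simp: pcoeff_times dest!: xy)
  also have "\<dots> = (\<Sum>r\<in>?C. \<Sum>m\<in>?A. pcoeff z r * (pcoeff x m * pcoeff y (l - r - m)))"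
  proof (rule sum.cong[OF refl], goal_cases)
    case (1 r)
    have "pmul x y (l - r) = (\<Sum>m\<in>?A. pcoeff x m * pcoeff y (l - r - m))"
      by (rule pmul_eq[OF fin]) (use 1 in \<open>auto dest!: b c\<close>)
    then show ?case by (simp add: sum_distrib_left)
  qed
  also have "\<dots> = (\<Sum>m\<in>?A. \<Sum>r\<in>?C. pcoeff x m * (pcoeff z r * pcoeff y (l - m - r)))"
    by (subst sum.swap) (simp add: algebra_simps)
  also have "\<dots> = (\<Sum>m\<in>?A. pcoeff x m * pmul y z (l - m))"
  proof (rule sum.cong[OF refl], goal_cases)
    case (1 m)
    have "pmul z y (l - m) = (\<Sum>r\<in>?C. pcoeff z r * pcoeff y (l - m - r))"
      by (rule pmul_eq[OF fin]) (use 1 in \<open>auto dest!: a b\<close>)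
    then show ?case by (simp add: sum_distrib_left pmul_commute[of y z])
  qed
  also have "\<dots> = pmul x (y * z) l"
    by (subst pmul_eq[OF fin[of "l - b - c" x]]) (auto simp: pcoeff_times dest!: yz)
  finally show ?thesis .
qed

instance
proof
  fix x y z :: puiseux
  show "x * y * z = x * (y * z)"
    by (rule puiseux_eqI) (simp add: pcoeff_times pmul_assoc)
  show "x * y = y * x"
    by (rule puiseux_eqI) (simp add: pcoeff_times pmul_commute)
  show "1 * x = x"
  proof (rule puiseux_eqI)
    fix l
    have "pmul 1 x l = (\<Sum>m\<in>{0}. pcoeff 1 m * pcoeff x (l - m))"
      by (rule pmul_eq) (auto simp: one_puiseux.rep_eq split: if_splits)
    then show "pcoeff (1 * x) l = pcoeff x l" by (simp add: pcoeff_times one_puiseux.rep_eq)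
  qed
  show "(x + y) * z = x * z + y * z"
  proof (rule puiseux_eqI)
    fix l
    let ?A = "{m. pcoeff x m \<noteq> 0 \<and> pcoeff z (l - m) \<noteq> 0} \<union> {m. pcoeff y m \<noteq> 0 \<and> pcoeff z (l - m) \<noteq> 0}"
    have f: "finite ?A" using finite_conv by blast
    have "pmul w z l = (\<Sum>m\<in>?A. pcoeff w m * pcoeff z (l - m))" if "w \<in> {x, y, x + y}" for w
      by (rule pmul_eq[OF f]) (use that in \<open>auto simp: plus_puiseux.rep_eq\<close>)
    then show "pcoeff ((x + y) * z) l = pcoeff (x * z + y * z) l"
      by (simp add: pcoeff_times plus_puiseux.rep_eq sum.distrib[symmetric] distrib_right)
  qed
  show "(0::puiseux) \<noteq> 1"
    by (metis one_puiseux.rep_eq zero_puiseux.rep_eq zero_neq_one)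
qed (transfer; simp add: fun_eq_iff)+

end

lemma pcoeff_eq_0_iff: "(\<forall>l. pcoeff x l = 0) \<longleftrightarrow> x = 0"
  by transfer (auto simp: fun_eq_iff)

lemma lexp:
  assumes "x \<noteq> 0"
  shows "pcoeff x (lexp x) \<noteq> 0" "\<And>l. pcoeff x l \<noteq> 0 \<Longrightarrow> l \<le> lexp x"
proof -
  obtain a where a: "pcoeff x a \<noteq> 0" using assms pcoeff_eq_0_iff by blast
  let ?A = "{l. a \<le> l \<and> pcoeff x l \<noteq> 0}"
  have fin: "finite ?A" by (rule finite_psupp_ge)
  have ne: "?A \<noteq> {}" using a by blast
  have 1: "pcoeff x (Max ?A) \<noteq> 0" using Max_in[OF fin ne] by blast
  have 2: "l \<le> Max ?A" if "pcoeff x l \<noteq> 0" for l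
    using Max_ge[OF fin, of l] Max_ge[OF fin, of a] that a by (cases "a \<le> l") auto
  have "lexp x = Max ?A"
    unfolding lexp_def by (rule Greatest_equality) (use 1 2 in auto)
  with 1 2 show "pcoeff x (lexp x) \<noteq> 0" "\<And>l. pcoeff x l \<noteq> 0 \<Longrightarrow> l \<le> lexp x" by auto
qed

lemma lexp_eqI: "pcoeff x a \<noteq> 0 \<Longrightarrow> (\<And>l. pcoeff x l \<noteq> 0 \<Longrightarrow> l \<le> a) \<Longrightarrow> lexp x = a"
  unfolding lexp_def by (rule Greatest_equality) auto

definition lc :: "puiseux \<Rightarrow> real" where
  "lc x = (if x = 0 then 0 else pcoeff x (lexp x))"

definition val :: "puiseux \<Rightarrow> ereal" where
  "val x = (if x = 0 then -\<infinity> else ereal (lexp x))"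

lemma lc_eq_0_iff [simp]: "lc x = 0 \<longleftrightarrow> x = 0"
  using lexp(1) by (auto simp: lc_def)

lemma lc_minus [simp]: "lc (- x) = - lc x"
  by (simp add: lc_def lexp_def uminus_puiseux.rep_eq)

lemma lc_add_pos:
  assumes "0 < lc x" "0 < lc y"
  shows "0 < lc (x + y)"
proof -
  have nz: "x \<noteq> 0" "y \<noteq> 0" using assms by (auto simp: lc_def)
  define a where "a = max (lexp x) (lexp y)"
  have xa: "0 \<le> pcoeff x a" "0 \<le> pcoeff y a" "0 < pcoeff x a + pcoeff y a"
  proof -
    have x: "0 < pcoeff x (lexp x)" "0 < pcoeff y (lexp y)" using assms nz by (auto simp: lc_def)
    have "pcoeff x a = 0 \<or> a = lexp x" "pcoeff y a = 0 \<or> a = lexp y"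
      using lexp(2)[OF nz(1), of a] lexp(2)[OF nz(2), of a] by (force simp: a_def max_def)+
    moreover have "a = lexp x \<or> a = lexp y" by (auto simp: a_def max_def)
    ultimately show "0 \<le> pcoeff x a" "0 \<le> pcoeff y a" "0 < pcoeff x a + pcoeff y a"
      using x by auto
  qed
  have "lexp (x + y) = a"
  proof (rule lexp_eqI)
    show "pcoeff (x + y) a \<noteq> 0" using xa by (simp add: plus_puiseux.rep_eq)
    fix l assume "pcoeff (x + y) l \<noteq> 0"
    then have "pcoeff x l \<noteq> 0 \<or> pcoeff y l \<noteq> 0" by (auto simp: plus_puiseux.rep_eq)
    then show "l \<le> a" using lexp(2) nz by (force simp: a_def)
  qed
  moreover have "x + y \<noteq> 0" using xa by (metis plus_puiseux.rep_eq zero_puiseux.rep_eq less_irrefl)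
  ultimately show ?thesis using xa by (simp add: lc_def plus_puiseux.rep_eq)
qed

lemma mult_lead:
  assumes "x \<noteq> 0" "y \<noteq> 0"
  shows "pcoeff (x * y) (lexp x + lexp y) = pcoeff x (lexp x) * pcoeff y (lexp y)"
    and "x * y \<noteq> 0" and "lexp (x * y) = lexp x + lexp y"
proof -
  have "pmul x y (lexp x + lexp y)
      = (\<Sum>m\<in>{lexp x}. pcoeff x m * pcoeff y (lexp x + lexp y - m))"
  proof (rule pmul_eq)
    fix m assume "pcoeff x m \<noteq> 0" "pcoeff y (lexp x + lexp y - m) \<noteq> 0"
    from this[THEN lexp(2)[rotated]] assms show "m \<in> {lexp x}" by force
  qed simp
  then show 1: "pcoeff (x * y) (lexp x + lexp y) = pcoeff x (lexp x) * pcoeff y (lexp y)"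
    by (simp add: pcoeff_times)
  then have 2: "pcoeff (x * y) (lexp x + lexp y) \<noteq> 0" using lexp(1) assms by simp
  then show "x * y \<noteq> 0" by (metis zero_puiseux.rep_eq)
  show "lexp (x * y) = lexp x + lexp y"
  proof (rule lexp_eqI[OF 2])
    fix l assume "pcoeff (x * y) l \<noteq> 0"
    then have "pmul x y l \<noteq> 0" by (simp add: pcoeff_times)
    then obtain m where "pcoeff x m \<noteq> 0" "pcoeff y (l - m) \<noteq> 0" by (rule pmul_nonzeroE)
    from this[THEN lexp(2)[rotated]] assms show "l \<le> lexp x + lexp y" by force
  qed
qed

lemma lc_mult [simp]: "lc (x * y) = lc x * lc y"
  by (cases "x = 0 \<or> y = 0") (auto simp: lc_def mult_lead)

lemma lc_one [simp]: "lc 1 = 1"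
proof -
  have "lexp 1 = 0" by (rule lexp_eqI) (auto simp: one_puiseux.rep_eq split: if_splits)
  then show ?thesis by (simp add: lc_def one_puiseux.rep_eq)
qed

subsection \<open>Inverses\<close>

lemma pcoeff_sum: "pcoeff (\<Sum>k\<in>A. f k) l = (\<Sum>k\<in>A. pcoeff (f k) l)"
  by (induction A rule: infinite_finite_induct)
    (auto simp: zero_puiseux.rep_eq plus_puiseux.rep_eq)

lemma pcoeff_mult_le:
  assumes "\<forall>l. pcoeff x l \<noteq> 0 \<longrightarrow> l \<le> a" "\<forall>l. pcoeff y l \<noteq> 0 \<longrightarrow> l \<le> b"
    and "pcoeff (x * y) l \<noteq> 0"
  shows "l \<le> a + b"
proof -
  obtain m where "pcoeff x m \<noteq> 0" "pcoeff y (l - m) \<noteq> 0"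
    using assms(3) unfolding pcoeff_times by (rule pmul_nonzeroE)
  with assms(1,2) show ?thesis by force
qed

lemma pcoeff_power_le:
  assumes "\<forall>l. pcoeff u l \<noteq> 0 \<longrightarrow> l \<le> - d" and "pcoeff (u ^ k) l \<noteq> 0"
  shows "l \<le> - (real k * d)"
  using assms(2)
proof (induction k arbitrary: l)
  case 0
  then show ?case by (auto simp: one_puiseux.rep_eq split: if_splits)
next
  case (Suc k)
  have "l \<le> - d + - (real k * d)"
    by (rule pcoeff_mult_le[OF assms(1)]) (use Suc in auto)
  then show ?case by (simp add: algebra_simps)
qed

text \<open>The geometric series: every coefficient of \<open>\<Sum>k. u^k\<close> is a finite sum.\<close>
lemma geometric_inverse:
  assumes d: "0 < d" and u: "\<forall>l. pcoeff u l \<noteq> 0 \<longrightarrow> l \<le> - d"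
  shows "\<exists>v. (1 - u) * v = 1"
proof -
  define N where "N = (\<lambda>l. nat \<lceil>- l / d\<rceil>)"
  define S where "S = (\<lambda>n. \<Sum>k\<le>n. u ^ k)"
  define g where "g = (\<lambda>l. pcoeff (S (N l)) l)"
  have N: "- (real k * d) < l" if "N l < k" for k l
  proof -
    have "- l / d \<le> of_int \<lceil>- l / d\<rceil>" by (rule le_of_int_ceiling)
    also have "\<dots> \<le> real (N l)" unfolding N_def by linarith
    also have "\<dots> < real k" using that by simp
    finally show ?thesis using d by (simp add: field_simps)
  qed
  have stable: "pcoeff (S n) l = g l" if "N l \<le> n" for n l
  proof -
    have z: "pcoeff (u ^ k) l = 0" if "N l < k" for k
      using pcoeff_power_le[OF u, of k l] N[OF that] by force
    have "(\<Sum>k\<le>n. pcoeff (u ^ k) l) = (\<Sum>k\<le>N l. pcoeff (u ^ k) l)"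
      by (rule sum.mono_neutral_right) (use that z in auto)
    then show ?thesis by (simp add: g_def S_def pcoeff_sum)
  qed
  have mono: "N l \<le> N a" if "a \<le> l" for a l
    unfolding N_def using that d by (intro nat_mono ceiling_mono divide_right_mono) auto
  have "finite {l. a \<le> l \<and> g l \<noteq> 0}" for a
    by (rule finite_subset[OF _ finite_psupp_ge[of a "S (N a)"]]) (use stable mono in auto)
  then have "pcoeff (Abs_puiseux g) = g" by (intro Abs_puiseux_inverse) auto
  then obtain v where v: "pcoeff v = g" by blast
  have u0: "\<forall>l. pcoeff (1 - u) l \<noteq> 0 \<longrightarrow> l \<le> 0"
    using u d by (fastforce simp: minus_puiseux.rep_eq one_puiseux.rep_eq split: if_splits)
  have "(1 - u) * v = 1"
  proof (rule puiseux_eqI)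
    fix l
    define n where "n = N (l - 1)"
    have low: "\<forall>k. pcoeff (v - S n) k \<noteq> 0 \<longrightarrow> k \<le> l - 1"
    proof (intro allI impI)
      fix k assume "pcoeff (v - S n) k \<noteq> 0"
      with stable[of k n] mono[of "l - 1" k] show "k \<le> l - 1"
        by (cases "k \<le> l - 1") (auto simp: minus_puiseux.rep_eq v n_def)
    qed
    have "pcoeff ((1 - u) * (v - S n)) l = 0"
      using pcoeff_mult_le[OF u0 low, of l] by force
    moreover have "pcoeff (u ^ Suc n) l = 0"
    proof -
      have "- (real (Suc n) * d) < l - 1" by (rule N) (simp add: n_def)
      then show ?thesis using pcoeff_power_le[OF u, of "Suc n" l] by force
    qed
    moreover have "(1 - u) * v = (1 - u) * (v - S n) + (1 - u ^ Suc n)"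
      by (simp only: S_def one_diff_power_eq lessThan_Suc_atMost) (simp add: algebra_simps)
    ultimately show "pcoeff ((1 - u) * v) l = pcoeff 1 l"
      by (simp only: plus_puiseux.rep_eq minus_puiseux.rep_eq)
  qed
  then show ?thesis by blast
qed

definition pmonom :: "real \<Rightarrow> real \<Rightarrow> puiseux" where
  "pmonom c a = Abs_puiseux (\<lambda>l. if l = a then c else 0)"

lemma pcoeff_pmonom: "pcoeff (pmonom c a) l = (if l = a then c else 0)"
  unfolding pmonom_def
  by (subst Abs_puiseux_inverse) (auto intro: finite_subset[of _ "{a}"])

lemma puiseux_inverse_ex:
  fixes x :: puiseux
  assumes "x \<noteq> 0"
  shows "\<exists>y. x * y = 1"
proof -
  define m where "m = pmonom (inverse (lc x)) (- lexp x)"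
  have lm: "lexp m = - lexp x"
    using assms by (intro lexp_eqI) (auto simp: m_def pcoeff_pmonom split: if_splits)
  have m0: "m \<noteq> 0"
    using assms pcoeff_pmonom[of "inverse (lc x)" "- lexp x" "- lexp x"]
    by (auto simp: m_def zero_puiseux.rep_eq)
  define u where "u = 1 - x * m"
  have "pcoeff m (- lexp x) = inverse (lc x)" by (simp add: m_def pcoeff_pmonom)
  then have xm: "lexp (x * m) = 0" "x * m \<noteq> 0" "pcoeff (x * m) 0 = 1"
    using mult_lead[OF assms m0] assms lexp(1)[OF assms] by (simp_all add: lm lc_def)
  have neg: "l < 0" if "pcoeff u l \<noteq> 0" for l
    using that lexp(2)[OF xm(2), of l] xm
    by (cases "l = 0") (auto simp: u_def minus_puiseux.rep_eq one_puiseux.rep_eq)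
  have "\<exists>d>0. \<forall>l. pcoeff u l \<noteq> 0 \<longrightarrow> l \<le> - d"
  proof (cases "u = 0")
    case True
    then show ?thesis by (auto simp: zero_puiseux.rep_eq intro: exI[of _ 1])
  next
    case False
    then show ?thesis using lexp[OF False] neg by (intro exI[of _ "- lexp u"]) auto
  qed
  then obtain d where "0 < d" "\<forall>l. pcoeff u l \<noteq> 0 \<longrightarrow> l \<le> - d" by blast
  then obtain v where "(1 - u) * v = 1" using geometric_inverse by blast
  then have "x * (m * v) = 1" by (simp add: u_def mult.assoc)
  then show ?thesis by blast
qed

instantiation puiseux :: linordered_field
begin

definition less_eq_puiseux :: "puiseux \<Rightarrow> puiseux \<Rightarrow> bool" where
  "y \<le> x \<longleftrightarrow> 0 \<le> lc (x - y)"

definition less_puiseux :: "puiseux \<Rightarrow> puiseux \<Rightarrow> bool" where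
  "y < x \<longleftrightarrow> y \<le> x \<and> \<not> x \<le> (y :: puiseux)"

definition abs_puiseux :: "puiseux \<Rightarrow> puiseux" where
  "\<bar>x\<bar> = (if x < 0 then - x else (x :: puiseux))"

definition sgn_puiseux :: "puiseux \<Rightarrow> puiseux" where
  "sgn x = (if x = 0 then 0 else if 0 < x then 1 else - (1 :: puiseux))"

definition inverse_puiseux :: "puiseux \<Rightarrow> puiseux" where
  "inverse x = (if x = 0 then 0 else THE y. x * y = (1 :: puiseux))"

definition divide_puiseux :: "puiseux \<Rightarrow> puiseux \<Rightarrow> puiseux" where
  "x div y = x * inverse (y :: puiseux)"

lemma lc_diff_commute: "lc (x - y) = - lc (y - x)"
  using lc_minus[of "y - x"] by simp

lemma less_puiseux_iff: "y < x \<longleftrightarrow> 0 < lc (x - y)"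
  unfolding less_puiseux_def less_eq_puiseux_def using lc_diff_commute[of x y] by auto

lemma le_puiseux_iff: "y \<le> x \<longleftrightarrow> y = x \<or> 0 < lc (x - y)"
  unfolding less_eq_puiseux_def using lc_eq_0_iff[of "x - y"] by (auto simp: order_le_less)

instance
proof
  fix x y z :: puiseux
  show "x < y \<longleftrightarrow> x \<le> y \<and> \<not> y \<le> x" by (rule less_puiseux_def)
  show "x \<le> x" by (simp add: le_puiseux_iff)
  show "x \<le> z" if "x \<le> y" "y \<le> z"
    using that lc_add_pos[of "z - y" "y - x"] by (auto simp: le_puiseux_iff)
  show "x = y" if "x \<le> y" "y \<le> x"
    using that lc_diff_commute[of x y] by (auto simp: le_puiseux_iff)
  show "x \<le> y \<or> y \<le> x"
    using lc_diff_commute[of x y] by (auto simp: less_eq_puiseux_def)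
  show "z + x \<le> z + y" if "x \<le> y" using that by (simp add: less_eq_puiseux_def)
  show "z * x < z * y" if "x < y" "0 < z"
    using that by (simp add: less_puiseux_iff flip: right_diff_distrib)
  show "\<bar>x\<bar> = (if x < 0 then - x else x)" by (rule abs_puiseux_def)
  show "sgn x = (if x = 0 then 0 else if 0 < x then 1 else - 1)" by (rule sgn_puiseux_def)
  show "inverse x * x = 1" if "x \<noteq> 0"
  proof -
    have "\<exists>!y. x * y = 1"
      using puiseux_inverse_ex[OF that] by (metis mult.assoc mult.commute mult.right_neutral)
    from theI'[OF this] show ?thesis using that by (simp add: inverse_puiseux_def mult.commute)
  qed
  show "x div y = x * inverse y" by (rule divide_puiseux_def)
  show "inverse (0 :: puiseux) = 0" by (simp add: inverse_puiseux_def)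
qed

end

section \<open>Polynomials and formal tropicalization\<close>

text \<open>
  Polynomials in variables indexed by \<open>'n\<close> are finitely supported maps from exponent vectors to
  coefficients.
\<close>

type_synonym ('n, 'a) mpolynomial = "(nat ^ 'n) \<Rightarrow>\<^sub>0 'a"

definition mpoly_eval :: "('n::finite, 'a::comm_semiring_1) mpolynomial \<Rightarrow> 'a ^ 'n \<Rightarrow> 'a" where
  "mpoly_eval P x = (\<Sum>\<alpha>\<in>Poly_Mapping.keys P.
     Poly_Mapping.lookup P \<alpha> * (\<Prod>j\<in>UNIV. x $ j ^ (\<alpha> $ j)))"

text \<open>
  Signed tropical numbers: the tropical zero \<open>-\<infinity>\<close>, and the reals with a positive or a negative sign.
\<close>

datatype signed_trop = TZero | TPos real | TNeg real

instantiation signed_trop :: zero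
begin
definition zero_signed_trop :: signed_trop where "0 = TZero"
instance ..
end

fun tsign :: "signed_trop \<Rightarrow> int" where
  "tsign TZero = 0"
| "tsign (TPos a) = 1"
| "tsign (TNeg a) = - 1"

fun modulus :: "signed_trop \<Rightarrow> ereal" where
  "modulus TZero = -\<infinity>"
| "modulus (TPos a) = ereal a"
| "modulus (TNeg a) = ereal a"

text \<open>The signed valuation.\<close>

definition sval :: "puiseux \<Rightarrow> signed_trop" where
  "sval x = (if x = 0 then TZero else if 0 < x then TPos (lexp x) else TNeg (lexp x))"

lemma modulus_sval: "modulus (sval x) = val x"
  by (simp add: sval_def val_def)

lemma tsign_sval: "tsign (sval x) = (if 0 < x then 1 else if x < 0 then - 1 else 0)"
  by (auto simp: sval_def)

type_synonym 'n trop_poly = "('n, signed_trop) mpolynomial"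

definition formal_trop :: "('n::finite, puiseux) mpolynomial \<Rightarrow> 'n trop_poly" where
  "formal_trop P = Poly_Mapping.map sval P"

lemma lookup_formal_trop: "Poly_Mapping.lookup (formal_trop P) \<alpha> = sval (Poly_Mapping.lookup P \<alpha>)"
  unfolding formal_trop_def
  by (simp add: Poly_Mapping.map.rep_eq when_def sval_def zero_signed_trop_def)

lemma keys_formal_trop: "Poly_Mapping.keys (formal_trop P) = Poly_Mapping.keys P"
  by (auto simp: in_keys_iff lookup_formal_trop sval_def zero_signed_trop_def)

definition trop_term :: "'n::finite trop_poly \<Rightarrow> nat ^ 'n \<Rightarrow> real ^ 'n \<Rightarrow> ereal" where
  "trop_term P \<alpha> x = modulus (Poly_Mapping.lookup P \<alpha>) + ereal ((\<chi> j. real (\<alpha> $ j)) \<bullet> x)"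

text \<open>The suprema are over finite sets of extended reals; over the empty set they are \<open>-\<infinity>\<close>.\<close>

definition trop_plus :: "'n::finite trop_poly \<Rightarrow> real ^ 'n \<Rightarrow> ereal" where
  "trop_plus P x =
    (SUP \<alpha>\<in>{\<alpha>\<in>Poly_Mapping.keys P. tsign (Poly_Mapping.lookup P \<alpha>) = 1}. trop_term P \<alpha> x)"

definition trop_minus :: "'n::finite trop_poly \<Rightarrow> real ^ 'n \<Rightarrow> ereal" where
  "trop_minus P x =
    (SUP \<alpha>\<in>{\<alpha>\<in>Poly_Mapping.keys P. tsign (Poly_Mapping.lookup P \<alpha>) = - 1}. trop_term P \<alpha> x)"

section \<open>The polyhedral complexes\<close>

definition Argmax :: "'n::finite trop_poly \<Rightarrow> real ^ 'n \<Rightarrow> (nat ^ 'n) set" where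
  "Argmax P x = {\<alpha>\<in>Poly_Mapping.keys P. \<forall>\<beta>\<in>Poly_Mapping.keys P. trop_term P \<beta> x \<le> trop_term P \<alpha> x}"

definition cell :: "'n::finite trop_poly \<Rightarrow> (nat ^ 'n) set \<Rightarrow> (real ^ 'n) set" where
  "cell P L = closure {x. Argmax P x = L}"

definition complex_of :: "'n::finite trop_poly \<Rightarrow> (real ^ 'n) set set" where
  "complex_of P = {cell P L | L. L \<subseteq> Poly_Mapping.keys P}"

definition complex_ge :: "'n::finite trop_poly \<Rightarrow> (real ^ 'n) set set" where
  "complex_ge P = {cell P L | L. L \<subseteq> Poly_Mapping.keys P \<and>
     (cell P L = {} \<or> (\<exists>\<alpha>\<in>L. tsign (Poly_Mapping.lookup P \<alpha>) = 1))}"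

lemma complex_ge_subset: "complex_ge P \<subseteq> complex_of P"
  by (auto simp: complex_ge_def complex_of_def)

text \<open>The complex of the family \<open>P 1, \<dots>, P m\<close>.\<close>

definition complexes_ge :: "nat \<Rightarrow> (nat \<Rightarrow> 'n::finite trop_poly) \<Rightarrow> (real ^ 'n) set set" where
  "complexes_ge m P = {\<Inter>i\<in>{1..m}. W i | W. \<forall>i\<in>{1..m}. W i \<in> complex_ge (P i)}"

definition complex_support :: "(real ^ 'n::finite) set set \<Rightarrow> (real ^ 'n) set" where
  "complex_support C = \<Union>C"

definition regular_set :: "'a::topological_space set \<Rightarrow> bool" where
  "regular_set S \<longleftrightarrow> closed S \<and> S = closure (interior S)"

end

theory Submission
  imports Defs
begin

text \<open>
  The inclusion of the valuations in the tropical set holds because the sign of \<open>\<^bold>P(\<^bold>z)\<close> is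
  the sign of the sum of the leading coefficients of the terms of highest exponent, that is, of those
  indexed by the argmax at \<open>x = val(\<^bold>z)\<close>, whenever this sum does not vanish (\<open>lc_mpoly_eval\<close>).
  If all these terms have negative coefficients, then \<open>\<^bold>P(\<^bold>z) < 0\<close>.

  For the other inclusion one has to lift every point \<open>x\<close> of the tropical set, also those where
  positive and negative terms tie. Two distinct terms only tie on a hyperplane. Since the tropical
  set is the closure of its interior, there are points \<open>y\<close> of it arbitrarily close to \<open>x\<close>
  that avoid these finitely many hyperplanes: for each \<open>i\<close> the maximum at \<open>y\<close> is attained by a single term
  \<open>\<alpha>\<^sub>i\<close>, of positive coefficient (\<open>generic_point_near\<close>). If \<open>y\<close> is close enough to \<open>x\<close>, then
  \<open>\<alpha>\<^sub>i\<close> is also maximal at \<open>x\<close> (\<open>Argmax_semicontinuous\<close>), so among the terms that are maximal at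
  \<open>x\<close> it is the one that grows fastest in the direction \<open>u = y - x\<close>. The value group being the
  reals, \<open>x\<close> cannot be moved infinitesimally towards \<open>y\<close>, but the leading coefficients can play this
  role: the lift \<open>\<^bold>z\<^sub>j = c\<^bsup>u\<^sub>j\<^esup> t\<^bsup>x\<^sub>j\<^esup>\<close> has valuation \<open>x\<close> for each real \<open>c > 0\<close>, and its
  leading terms are weighted by \<open>c\<^bsup>\<langle>\<alpha>,u\<rangle>\<^esup>\<close>. For large \<open>c\<close> the term \<open>\<alpha>\<^sub>i\<close> therefore decides the sign
  of \<open>\<^bold>P\<^sub>i(\<^bold>z)\<close>, for all \<open>i\<close> at the same time (\<open>lift_generic_direction\<close>).
\<close>

section \<open>Leading terms of sums, products and polynomial values\<close>

lemma lc_pos_iff: "0 < lc x \<longleftrightarrow> 0 < x"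
  using less_puiseux_iff[of 0 x] by simp

lemma lc_neg_iff: "lc x < 0 \<longleftrightarrow> x < 0"
  using lc_pos_iff[of "- x"] by simp

lemma lc_power: "lc (x ^ k) = lc x ^ k"
  by (induction k) auto

lemma lc_prod: "lc (\<Prod>j\<in>A. f j) = (\<Prod>j\<in>A. lc (f j))"
  by (induction A rule: infinite_finite_induct) auto

lemma lexp_one: "lexp 1 = 0"
  by (rule lexp_eqI) (auto simp: one_puiseux.rep_eq split: if_splits)

lemma lexp_power: "x \<noteq> 0 \<Longrightarrow> lexp (x ^ k) = real k * lexp x"
  by (induction k) (auto simp: lexp_one mult_lead algebra_simps)

lemma lexp_prod:
  assumes "\<And>j. j \<in> A \<Longrightarrow> f j \<noteq> 0"
  shows "lexp (\<Prod>j\<in>A. f j) = (\<Sum>j\<in>A. lexp (f j))"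
  using assms by (induction A rule: infinite_finite_induct) (auto simp: lexp_one mult_lead)

lemma pcoeff_eq_lc:
  assumes "x \<noteq> 0" "lexp x \<le> l"
  shows "pcoeff x l = (if lexp x = l then lc x else 0)"
  using assms lexp(2)[of x l] by (auto simp: lc_def)

text \<open>
  The coefficient of the sum at the highest exponent \<open>M\<close> is \<open>s\<close>; as long as these contributions do
  not cancel, it is the leading one.
\<close>
lemma lc_sum:
  assumes fin: "finite A" and nz: "\<And>a. a \<in> A \<Longrightarrow> f a \<noteq> 0" and le: "\<And>a. a \<in> A \<Longrightarrow> lexp (f a) \<le> M"
    and s: "s = (\<Sum>a\<in>{a\<in>A. lexp (f a) = M}. lc (f a))" "s \<noteq> 0"
  shows "lc (sum f A) = s"
proof -
  have "pcoeff (sum f A) M = (\<Sum>a\<in>A. if lexp (f a) = M then lc (f a) else 0)"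
    unfolding pcoeff_sum by (intro sum.cong refl pcoeff_eq_lc nz le)
  also have "\<dots> = s" unfolding s(1) by (rule sum.inter_filter[OF fin, symmetric])
  finally have M: "pcoeff (sum f A) M = s" .
  have "lexp (sum f A) = M"
  proof (rule lexp_eqI)
    show "pcoeff (sum f A) M \<noteq> 0" using M s(2) by simp
    fix l assume "pcoeff (sum f A) l \<noteq> 0"
    then obtain a where "a \<in> A" "pcoeff (f a) l \<noteq> 0"
      unfolding pcoeff_sum by (rule sum.not_neutral_contains_not_neutral)
    then show "l \<le> M" using lexp(2)[OF nz] le by force
  qed
  moreover have "sum f A \<noteq> 0" using M s(2) by (metis zero_puiseux.rep_eq)
  ultimately show ?thesis by (simp add: lc_def M)
qed

text \<open>
  For \<open>\<alpha>\<close> in the support of \<open>P\<close>, the exponent of the leading term of \<open>\<^bold>a\<^sub>\<alpha> \<^bold>z\<^sup>\<alpha>\<close> when \<open>\<^bold>z\<close> has valuation \<open>x\<close>.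
\<close>
definition term_exp :: "('n::finite, puiseux) mpolynomial \<Rightarrow> nat ^ 'n \<Rightarrow> real ^ 'n \<Rightarrow> real" where
  "term_exp P \<alpha> x = lexp (Poly_Mapping.lookup P \<alpha>) + (\<chi> j. real (\<alpha> $ j)) \<bullet> x"

lemma trop_term_formal_trop:
  "\<alpha> \<in> Poly_Mapping.keys P \<Longrightarrow> trop_term (formal_trop P) \<alpha> x = ereal (term_exp P \<alpha> x)"
  by (auto simp: trop_term_def term_exp_def lookup_formal_trop modulus_sval val_def in_keys_iff)

lemma Argmax_formal_trop:
  "Argmax (formal_trop P) x = {\<alpha>\<in>Poly_Mapping.keys P.
     \<forall>\<beta>\<in>Poly_Mapping.keys P. term_exp P \<beta> x \<le> term_exp P \<alpha> x}"
  unfolding Argmax_def keys_formal_trop by (auto simp: trop_term_formal_trop)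

lemma Argmax_nonempty:
  assumes "P \<noteq> 0"
  obtains \<alpha> where "\<alpha> \<in> Argmax (formal_trop P) x"
proof -
  let ?K = "Poly_Mapping.keys P"
  have "Max ((\<lambda>\<alpha>. term_exp P \<alpha> x) ` ?K) \<in> (\<lambda>\<alpha>. term_exp P \<alpha> x) ` ?K"
    using assms by (intro Max_in) auto
  then obtain \<alpha> where \<alpha>: "\<alpha> \<in> ?K" "Max ((\<lambda>\<alpha>. term_exp P \<alpha> x) ` ?K) = term_exp P \<alpha> x"
    by (rule imageE)
  have "term_exp P \<beta> x \<le> term_exp P \<alpha> x" if "\<beta> \<in> ?K" for \<beta>
    unfolding \<alpha>(2)[symmetric] using that by (intro Max_ge) auto
  with \<alpha>(1) have "\<alpha> \<in> Argmax (formal_trop P) x" by (simp add: Argmax_formal_trop)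
  then show ?thesis by (rule that)
qed

lemma finite_Argmax: "finite (Argmax (formal_trop P) x)"
  unfolding Argmax_formal_trop by simp

text \<open>
  The leading terms of the monomials that reach the highest exponent are those indexed by the
  argmax at the valuation of \<open>\<^bold>z\<close>; the value of the polynomial inherits their sum unless they cancel.
\<close>
lemma lc_mpoly_eval:
  fixes z :: "puiseux ^ 'n::finite"
  assumes z: "\<And>j. z $ j \<noteq> 0" and x: "\<And>j. x $ j = lexp (z $ j)"
    and s: "s = (\<Sum>\<alpha>\<in>Argmax (formal_trop P) x.
      lc (Poly_Mapping.lookup P \<alpha>) * (\<Prod>j\<in>UNIV. lc (z $ j) ^ (\<alpha> $ j)))" "s \<noteq> 0"
  shows "lc (mpoly_eval P z) = s"
proof -
  define f where "f \<alpha> = Poly_Mapping.lookup P \<alpha> * (\<Prod>j\<in>UNIV. z $ j ^ (\<alpha> $ j))" for \<alpha>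
  have "Argmax (formal_trop P) x \<noteq> {}"
  proof
    assume "Argmax (formal_trop P) x = {}"
    with s(1) have "s = 0" by (simp only: sum.empty)
    with s(2) show False ..
  qed
  then obtain \<alpha>0 where \<alpha>0: "\<alpha>0 \<in> Argmax (formal_trop P) x" by blast
  have nz: "f \<alpha> \<noteq> 0" if "\<alpha> \<in> Poly_Mapping.keys P" for \<alpha>
    using that z by (simp add: f_def in_keys_iff)
  have ex: "lexp (f \<alpha>) = term_exp P \<alpha> x" if "\<alpha> \<in> Poly_Mapping.keys P" for \<alpha>
    using that z
    by (simp add: f_def in_keys_iff mult_lead lexp_prod lexp_power term_exp_def inner_vec_def x)
  have lc: "lc (f \<alpha>) = lc (Poly_Mapping.lookup P \<alpha>) * (\<Prod>j\<in>UNIV. lc (z $ j) ^ (\<alpha> $ j))" for \<alpha>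
    by (simp add: f_def lc_prod lc_power)
  have set: "Argmax (formal_trop P) x
      = {\<alpha>\<in>Poly_Mapping.keys P. lexp (f \<alpha>) = term_exp P \<alpha>0 x}"
    using \<alpha>0 ex unfolding Argmax_formal_trop by (auto intro: antisym)
  have "lc (sum f (Poly_Mapping.keys P)) = s"
  proof (rule lc_sum[OF finite_keys nz])
    show "lexp (f \<alpha>) \<le> term_exp P \<alpha>0 x" if "\<alpha> \<in> Poly_Mapping.keys P" for \<alpha>
      using that ex \<alpha>0 unfolding Argmax_formal_trop by auto
    show "s = (\<Sum>\<alpha>\<in>{\<alpha>\<in>Poly_Mapping.keys P. lexp (f \<alpha>) = term_exp P \<alpha>0 x}. lc (f \<alpha>))"
      using s(1) by (simp only: lc set)
  qed (use s in auto)
  then show ?thesis by (simp add: mpoly_eval_def f_def)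
qed

section \<open>The tropical set and the support of the complex\<close>

lemma tsign_formal_trop:
  "tsign (Poly_Mapping.lookup (formal_trop P) \<alpha>) = 1 \<longleftrightarrow> 0 < Poly_Mapping.lookup P \<alpha>"
  "tsign (Poly_Mapping.lookup (formal_trop P) \<alpha>) = - 1 \<longleftrightarrow> Poly_Mapping.lookup P \<alpha> < 0"
  by (auto simp: lookup_formal_trop tsign_sval)

text \<open>
  This form treats the empty maxima \<open>-\<infinity>\<close> uniformly: the overall maximum is attained by some
  term, and \<open>P\<^sup>- \<le> P\<^sup>+\<close> means that one of positive sign attains it.
\<close>
lemma trop_minus_le_plus_iff:
  assumes "P \<noteq> 0"
  shows "trop_minus (formal_trop P) x \<le> trop_plus (formal_trop P) x
    \<longleftrightarrow> (\<exists>\<alpha>\<in>Argmax (formal_trop P) x. 0 < Poly_Mapping.lookup P \<alpha>)"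
proof
  let ?P = "formal_trop P" and ?K = "Poly_Mapping.keys P"
  let ?Pos = "{\<alpha>\<in>?K. 0 < Poly_Mapping.lookup P \<alpha>}"
  have plus: "trop_plus ?P x = (SUP \<alpha>\<in>?Pos. trop_term ?P \<alpha> x)"
    by (simp add: trop_plus_def keys_formal_trop tsign_formal_trop)
  have minus: "trop_minus ?P x
      = (SUP \<alpha>\<in>{\<alpha>\<in>?K. Poly_Mapping.lookup P \<alpha> < 0}. trop_term ?P \<alpha> x)"
    by (simp add: trop_minus_def keys_formal_trop tsign_formal_trop)
  {
    assume le: "trop_minus ?P x \<le> trop_plus ?P x"
    obtain \<alpha> where \<alpha>: "\<alpha> \<in> Argmax ?P x" using Argmax_nonempty[OF assms] .
    then have K: "\<alpha> \<in> ?K" by (simp add: Argmax_formal_trop)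
    show "\<exists>\<alpha>\<in>Argmax ?P x. 0 < Poly_Mapping.lookup P \<alpha>"
    proof (cases "0 < Poly_Mapping.lookup P \<alpha>")
      case False
      with K have "\<alpha> \<in> {\<alpha>\<in>?K. Poly_Mapping.lookup P \<alpha> < 0}" by (auto simp: in_keys_iff)
      then have "trop_term ?P \<alpha> x \<le> trop_minus ?P x" unfolding minus by (rule SUP_upper)
      with le have 1: "trop_term ?P \<alpha> x \<le> trop_plus ?P x" by simp
      have ne: "?Pos \<noteq> {}"
      proof
        assume "?Pos = {}"
        then have "trop_plus ?P x = -\<infinity>" unfolding plus by (simp only: SUP_empty bot_ereal_def)
        with 1 trop_term_formal_trop[OF K, of x] show False by simp
      qed
      have fin: "finite ?Pos" by simp
      have "trop_plus ?P x = Max ((\<lambda>\<alpha>. trop_term ?P \<alpha> x) ` ?Pos)"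
        unfolding plus using ne fin by (intro Max_Sup[symmetric]) auto
      also have "\<dots> \<in> (\<lambda>\<alpha>. trop_term ?P \<alpha> x) ` ?Pos" using ne fin by (intro Max_in) auto
      finally obtain \<gamma> where \<gamma>: "\<gamma> \<in> ?Pos" "trop_plus ?P x = trop_term ?P \<gamma> x" by auto
      have "\<gamma> \<in> Argmax ?P x"
        using \<alpha> \<gamma> 1 unfolding Argmax_def keys_formal_trop by (auto intro: order_trans)
      with \<gamma> show ?thesis by blast
    qed (use \<alpha> in blast)
  next
    assume "\<exists>\<alpha>\<in>Argmax ?P x. 0 < Poly_Mapping.lookup P \<alpha>"
    then obtain \<alpha> where \<alpha>: "\<alpha> \<in> Argmax ?P x" "0 < Poly_Mapping.lookup P \<alpha>" by blast
    then have "\<alpha> \<in> ?Pos" by (simp add: Argmax_formal_trop)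
    then have "trop_term ?P \<alpha> x \<le> trop_plus ?P x" unfolding plus by (rule SUP_upper)
    then show "trop_minus ?P x \<le> trop_plus ?P x"
      unfolding minus using \<alpha>(1)
      by (intro SUP_least) (auto simp: Argmax_def keys_formal_trop intro: order_trans)
  }
qed

lemma continuous_term_exp: "continuous_on UNIV (term_exp P \<alpha>)"
  unfolding term_exp_def by (intro continuous_intros)

lemma closed_positive_Argmax:
  "closed {x. \<exists>\<alpha>\<in>Argmax (formal_trop P) x. 0 < Poly_Mapping.lookup P \<alpha>}"
proof -
  have "{x. \<exists>\<alpha>\<in>Argmax (formal_trop P) x. 0 < Poly_Mapping.lookup P \<alpha>}
    = (\<Union>\<alpha>\<in>{\<alpha>\<in>Poly_Mapping.keys P. 0 < Poly_Mapping.lookup P \<alpha>}.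
        \<Inter>\<beta>\<in>Poly_Mapping.keys P. {x. term_exp P \<beta> x \<le> term_exp P \<alpha> x})"
    by (auto simp: Argmax_formal_trop)
  also have "closed \<dots>"
    by (intro closed_UN closed_INT ballI closed_Collect_le continuous_term_exp) simp
  finally show ?thesis .
qed

text \<open>
  A point lies in the cell of its own argmax; conversely, taking closures of cells adds no point
  because having a positive maximal term is a closed condition.
\<close>
lemma Union_complex_ge:
  "\<Union>(complex_ge (formal_trop P))
    = {x. \<exists>\<alpha>\<in>Argmax (formal_trop P) x. 0 < Poly_Mapping.lookup P \<alpha>}" (is "?U = ?T")
proof
  show "?U \<subseteq> ?T"
  proof
    fix x assume "x \<in> ?U"
    then obtain L where L: "x \<in> cell (formal_trop P) L" "\<exists>\<alpha>\<in>L. 0 < Poly_Mapping.lookup P \<alpha>"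
      by (auto simp: complex_ge_def tsign_formal_trop)
    have "cell (formal_trop P) L \<subseteq> ?T"
      unfolding cell_def by (rule closure_minimal[OF _ closed_positive_Argmax]) (use L(2) in auto)
    with L(1) show "x \<in> ?T" by blast
  qed
  show "?T \<subseteq> ?U"
  proof
    fix x assume x: "x \<in> ?T"
    let ?c = "cell (formal_trop P) (Argmax (formal_trop P) x)"
    have "x \<in> ?c" unfolding cell_def by (rule closure_subset[THEN subsetD]) simp
    moreover have "Argmax (formal_trop P) x \<subseteq> Poly_Mapping.keys (formal_trop P)"
      by (auto simp: Argmax_def)
    then have "?c \<in> complex_ge (formal_trop P)"
      using x unfolding complex_ge_def by (auto simp: tsign_formal_trop)
    ultimately show "x \<in> ?U" by blast
  qed
qed

lemma complex_support_complexes_ge: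
  "complex_support (complexes_ge m P) = (\<Inter>i\<in>{1..m}. \<Union>(complex_ge (P i)))"
proof (rule set_eqI)
  fix x
  have "x \<in> complex_support (complexes_ge m P)
      \<longleftrightarrow> (\<exists>W. \<forall>i\<in>{1..m}. W i \<in> complex_ge (P i) \<and> x \<in> W i)"
    unfolding complex_support_def complexes_ge_def by blast
  also have "\<dots> \<longleftrightarrow> x \<in> (\<Inter>i\<in>{1..m}. \<Union>(complex_ge (P i)))"
    using bchoice_iff[of "{1..m}" "\<lambda>i W. W \<in> complex_ge (P i) \<and> x \<in> W"]
    by (simp add: Bex_def)
  finally show "x \<in> complex_support (complexes_ge m P)
      \<longleftrightarrow> x \<in> (\<Inter>i\<in>{1..m}. \<Union>(complex_ge (P i)))" .
qed

section \<open>Generic points\<close>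

text \<open>
  The terms that are strictly below the maximum at \<open>x\<close> stay below it nearby, by continuity.
\<close>
lemma Argmax_semicontinuous:
  assumes "P \<noteq> 0"
  shows "\<forall>\<^sub>F y in nhds x. Argmax (formal_trop P) y \<subseteq> Argmax (formal_trop P) x"
proof -
  obtain \<gamma> where \<gamma>: "\<gamma> \<in> Argmax (formal_trop P) x" using Argmax_nonempty[OF assms] .
  let ?B = "Poly_Mapping.keys P - Argmax (formal_trop P) x"
  have "\<forall>\<^sub>F y in nhds x. \<forall>\<beta>\<in>?B. term_exp P \<beta> y < term_exp P \<gamma> y"
  proof (rule eventually_ball_finite)
    show "\<forall>\<beta>\<in>?B. \<forall>\<^sub>F y in nhds x. term_exp P \<beta> y < term_exp P \<gamma> y"
    proof
      fix \<beta> assume \<beta>: "\<beta> \<in> ?B"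
      have "open {y. term_exp P \<beta> y < term_exp P \<gamma> y}"
        by (intro open_Collect_less continuous_term_exp)
      moreover have "term_exp P \<beta> x < term_exp P \<gamma> x"
        using \<beta> \<gamma> unfolding Argmax_formal_trop by force
      ultimately show "\<forall>\<^sub>F y in nhds x. term_exp P \<beta> y < term_exp P \<gamma> y"
        by (auto simp: eventually_nhds)
    qed
  qed simp
  then show ?thesis
  proof eventually_elim
    case (elim y)
    have "\<gamma> \<in> Poly_Mapping.keys P" using \<gamma> by (simp add: Argmax_formal_trop)
    with elim show ?case unfolding Argmax_formal_trop[of P y] by (fastforce simp: not_less[symmetric])
  qed
qed

text \<open>Two distinct exponent vectors only tie on a hyperplane.\<close>
lemma negligible_ties:
  fixes P :: "('n::finite, puiseux) mpolynomial"
  shows "negligible {x. \<exists>\<alpha>\<in>Argmax (formal_trop P) x. Argmax (formal_trop P) x \<noteq> {\<alpha>}}"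
proof -
  let ?K = "Poly_Mapping.keys P"
  have tie: "negligible {x. term_exp P \<alpha> x = term_exp P \<beta> x}" if "\<alpha> \<noteq> \<beta>" for \<alpha> \<beta> :: "nat ^ 'n"
  proof -
    let ?d = "(\<chi> j. real (\<alpha> $ j)) - (\<chi> j. real (\<beta> $ j))"
    have "?d \<noteq> 0" using that by (simp add: vec_eq_iff)
    then have "negligible {x. ?d \<bullet> x
        = lexp (Poly_Mapping.lookup P \<beta>) - lexp (Poly_Mapping.lookup P \<alpha>)}"
      by (intro negligible_hyperplane) simp
    then show ?thesis by (rule negligible_subset) (auto simp: term_exp_def inner_diff_left)
  qed
  have "finite {(\<alpha>, \<beta>)\<in>?K \<times> ?K. \<alpha> \<noteq> \<beta>}"
    by (rule finite_subset[of _ "?K \<times> ?K"]) auto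
  then have "negligible (\<Union>(\<alpha>, \<beta>)\<in>{(\<alpha>, \<beta>)\<in>?K \<times> ?K. \<alpha> \<noteq> \<beta>}. {x. term_exp P \<alpha> x = term_exp P \<beta> x})"
    by (intro negligible_Union finite_imageI) (auto intro: tie)
  then show ?thesis
  proof (rule negligible_subset)
    show "{x. \<exists>\<alpha>\<in>Argmax (formal_trop P) x. Argmax (formal_trop P) x \<noteq> {\<alpha>}}
      \<subseteq> (\<Union>(\<alpha>, \<beta>)\<in>{(\<alpha>, \<beta>)\<in>?K \<times> ?K. \<alpha> \<noteq> \<beta>}. {x. term_exp P \<alpha> x = term_exp P \<beta> x})"
    proof clarify
      fix x \<alpha> assume \<alpha>: "\<alpha> \<in> Argmax (formal_trop P) x" "Argmax (formal_trop P) x \<noteq> {\<alpha>}"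
      then obtain \<beta> where \<beta>: "\<beta> \<in> Argmax (formal_trop P) x" "\<alpha> \<noteq> \<beta>" by blast
      with \<alpha>(1) have "\<alpha> \<in> ?K" "\<beta> \<in> ?K" "term_exp P \<alpha> x = term_exp P \<beta> x"
        by (auto simp: Argmax_formal_trop intro: antisym)
      with \<beta>(2) show "x \<in> (\<Union>(\<alpha>, \<beta>)\<in>{(\<alpha>, \<beta>)\<in>?K \<times> ?K. \<alpha> \<noteq> \<beta>}.
          {x. term_exp P \<alpha> x = term_exp P \<beta> x})" by blast
    qed
  qed
qed

text \<open>
  Regularity gives an open subset of the tropical set close to \<open>x\<close>, and a nonempty open set is not
  covered by the finitely many hyperplanes of ties.
\<close>
lemma generic_point_near:
  fixes P :: "'i \<Rightarrow> ('n::finite, puiseux) mpolynomial"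
  assumes "finite I"
    and T: "T = {x. \<forall>i\<in>I. \<exists>\<alpha>\<in>Argmax (formal_trop (P i)) x. 0 < Poly_Mapping.lookup (P i) \<alpha>}"
    and "regular_set T" "x \<in> T" "open U" "x \<in> U"
  obtains y where "y \<in> U"
    "\<forall>i\<in>I. \<exists>\<alpha>. Argmax (formal_trop (P i)) y = {\<alpha>} \<and> 0 < Poly_Mapping.lookup (P i) \<alpha>"
proof -
  let ?N = "\<Union>i\<in>I. {x. \<exists>\<alpha>\<in>Argmax (formal_trop (P i)) x. Argmax (formal_trop (P i)) x \<noteq> {\<alpha>}}"
  have "negligible ?N"
    using assms(1) by (intro negligible_Union) (auto intro: negligible_ties)
  moreover have "x \<in> closure (interior T)" using assms(3,4) unfolding regular_set_def by blast
  then have "U \<inter> interior T \<noteq> {}"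
    using assms(5,6) open_Int_closure_eq_empty[of U "interior T"] by blast
  then have "\<not> negligible (U \<inter> interior T)"
    using assms(5) by (intro open_not_negligible) auto
  ultimately have "\<not> U \<inter> interior T \<subseteq> ?N" using negligible_subset by blast
  then obtain y where y: "y \<in> U" "y \<in> interior T" "y \<notin> ?N" by blast
  have "y \<in> T" using y(2) interior_subset by blast
  have "\<exists>\<alpha>. Argmax (formal_trop (P i)) y = {\<alpha>} \<and> 0 < Poly_Mapping.lookup (P i) \<alpha>"
    if "i \<in> I" for i
    using \<open>y \<in> T\<close> y(3) that unfolding T by blast
  with y(1) show ?thesis by (intro that) auto
qed

section \<open>Lifting\<close>

lemma lexp_pmonom: "c \<noteq> 0 \<Longrightarrow> lexp (pmonom c a) = a"
  by (rule lexp_eqI) (auto simp: pcoeff_pmonom split: if_splits)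

lemma lc_pmonom [simp]: "lc (pmonom c a) = c"
proof (cases "c = 0")
  case True
  then have "pmonom c a = 0" by (intro puiseux_eqI) (simp add: pcoeff_pmonom zero_puiseux.rep_eq)
  with True show ?thesis by simp
next
  case False
  then have "pmonom c a \<noteq> 0" by (metis pcoeff_pmonom zero_puiseux.rep_eq)
  with False show ?thesis by (simp add: lc_def lexp_pmonom pcoeff_pmonom)
qed

lemma prod_powr:
  fixes u :: "real ^ 'n::finite" and \<alpha> :: "nat ^ 'n"
  assumes "0 < c"
  shows "(\<Prod>j\<in>UNIV. (c powr (u $ j)) ^ (\<alpha> $ j)) = c powr ((\<chi> j. real (\<alpha> $ j)) \<bullet> u)"
  using assms
  by (simp add: inner_vec_def powr_sum powr_powr mult.commute flip: powr_realpow)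

text \<open>
  Divided by \<open>c\<^bsup>e k\<^esup>\<close>, the sum tends to \<open>a k\<close>.
\<close>
lemma eventually_sum_powr_pos:
  fixes a e :: "'b \<Rightarrow> real"
  assumes "finite A" "k \<in> A" "0 < a k" and lt: "\<And>b. b \<in> A \<Longrightarrow> b \<noteq> k \<Longrightarrow> e b < e k"
  shows "\<forall>\<^sub>F c in at_top. 0 < (\<Sum>b\<in>A. a b * c powr e b)"
proof -
  have "((\<lambda>c::real. \<Sum>b\<in>A - {k}. a b * c powr (e b - e k)) \<longlongrightarrow> (\<Sum>b\<in>A - {k}. a b * 0)) at_top"
    by (intro tendsto_sum tendsto_mult tendsto_const tendsto_neg_powr filterlim_ident)
      (use lt in auto)
  then have "\<forall>\<^sub>F c in at_top. - a k < (\<Sum>b\<in>A - {k}. a b * c powr (e b - e k))"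
    by (rule order_tendstoD(1)) (use assms(3) in simp)
  then show ?thesis
    using eventually_gt_at_top[of 0]
  proof eventually_elim
    case (elim c)
    have "(\<Sum>b\<in>A. a b * c powr e b)
        = c powr e k * (a k + (\<Sum>b\<in>A - {k}. a b * c powr (e b - e k)))"
      using elim(2) assms(1,2)
      by (simp add: sum.remove[of A k] distrib_left sum_distrib_left powr_diff)
    with elim show ?case by simp
  qed
qed

text \<open>
  Every lift of this form has valuation \<open>x\<close>, so the terms of highest exponent stay the same while
  their coefficients get multiplied by \<open>c\<^bsup>\<langle>\<alpha>,u\<rangle>\<^esup>\<close>; the steepest one is positive and wins for large
  \<open>c\<close>.
\<close>
lemma lift_generic_direction:
  fixes P :: "('n::finite, puiseux) mpolynomial"
  assumes k: "k \<in> Argmax (formal_trop P) x" "0 < Poly_Mapping.lookup P k"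
    and u: "\<And>\<beta>. \<beta> \<in> Argmax (formal_trop P) x \<Longrightarrow> \<beta> \<noteq> k \<Longrightarrow>
      (\<chi> j. real (\<beta> $ j)) \<bullet> u < (\<chi> j. real (k $ j)) \<bullet> u"
  shows "\<forall>\<^sub>F c in at_top. 0 < mpoly_eval P (\<chi> j. pmonom (c powr (u $ j)) (x $ j))"
proof -
  have "\<forall>\<^sub>F c in at_top. 0 < (\<Sum>\<alpha>\<in>Argmax (formal_trop P) x.
      lc (Poly_Mapping.lookup P \<alpha>) * c powr ((\<chi> j. real (\<alpha> $ j)) \<bullet> u))"
    using k u by (intro eventually_sum_powr_pos[of _ k]) (auto simp: finite_Argmax lc_pos_iff)
  then show ?thesis
    using eventually_gt_at_top[of 0]
  proof eventually_elim
    case (elim c)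
    define z where "z = (\<chi> j. pmonom (c powr (u $ j)) (x $ j))"
    have lc: "lc (z $ j) = c powr (u $ j)" for j by (simp add: z_def)
    have "lc (z $ j) \<noteq> 0" for j unfolding lc using elim(2) by simp
    then have nz: "z $ j \<noteq> 0" for j by simp
    have lexp: "x $ j = lexp (z $ j)" for j using elim(2) by (simp add: z_def lexp_pmonom)
    have "lc (mpoly_eval P z) = (\<Sum>\<alpha>\<in>Argmax (formal_trop P) x.
      lc (Poly_Mapping.lookup P \<alpha>) * c powr ((\<chi> j. real (\<alpha> $ j)) \<bullet> u))"
      by (rule lc_mpoly_eval[OF nz lexp]) (use elim in \<open>simp_all add: lc prod_powr\<close>)
    with elim show ?case by (simp add: z_def flip: lc_pos_iff)
  qed
qed

text \<open>
  If all terms of highest exponent at the valuation of \<open>\<^bold>z\<close> were negative, they could not cancel and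
  would determine the sign.
\<close>
lemma positive_Argmax_of_nonneg:
  fixes z :: "puiseux ^ 'n::finite"
  assumes "P \<noteq> 0" and z: "\<And>j. 0 < z $ j" and "0 \<le> mpoly_eval P z"
  shows "\<exists>\<alpha>\<in>Argmax (formal_trop P) (\<chi> j. lexp (z $ j)). 0 < Poly_Mapping.lookup P \<alpha>"
proof (rule ccontr)
  let ?A = "Argmax (formal_trop P) (\<chi> j. lexp (z $ j))"
  assume no: "\<not> ?thesis"
  have neg: "lc (Poly_Mapping.lookup P \<alpha>) < 0" if "\<alpha> \<in> ?A" for \<alpha>
    using no that by (force simp: lc_neg_iff Argmax_formal_trop in_keys_iff)
  have "?A \<noteq> {}" using Argmax_nonempty[OF assms(1)] by blast
  moreover have "0 < lc (z $ j)" for j using z by (simp add: lc_pos_iff)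
  ultimately have "(\<Sum>\<alpha>\<in>?A. lc (Poly_Mapping.lookup P \<alpha>) * (\<Prod>j\<in>UNIV. lc (z $ j) ^ (\<alpha> $ j)))
      < (\<Sum>\<alpha>\<in>?A. 0)"
    by (intro sum_strict_mono finite_Argmax mult_neg_pos neg prod_pos) auto
  then have s: "(\<Sum>\<alpha>\<in>?A. lc (Poly_Mapping.lookup P \<alpha>) * (\<Prod>j\<in>UNIV. lc (z $ j) ^ (\<alpha> $ j))) < 0"
    by simp
  have "lc (mpoly_eval P z)
      = (\<Sum>\<alpha>\<in>?A. lc (Poly_Mapping.lookup P \<alpha>) * (\<Prod>j\<in>UNIV. lc (z $ j) ^ (\<alpha> $ j)))"
    using z s by (intro lc_mpoly_eval[OF _ _ refl]) (auto simp: less_imp_neq[symmetric])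
  with s have "mpoly_eval P z < 0" by (simp flip: lc_neg_iff)
  with assms(3) show False by simp
qed

section \<open>Valuations of semialgebraic sets with regular tropicalization\<close>

theorem corollary4p8:
  fixes m :: nat
    and P :: "nat \<Rightarrow> ('n::finite, puiseux) mpolynomial"
    and box :: "nat \<Rightarrow> puiseux \<Rightarrow> puiseux \<Rightarrow> bool"
    and S :: "(puiseux ^ 'n) set"
  assumes "\<forall>i\<in>{1..m}. P i \<noteq> 0"
    and "\<forall>i\<in>{1..m}. box i \<in> {(\<ge>), (>)}"
    and "S = {z. (\<forall>j. z $ j > 0) \<and> (\<forall>i\<in>{1..m}. box i (mpoly_eval (P i) z) 0)}"
    and "regular_set (complex_support (complexes_ge m (\<lambda>i. formal_trop (P i))))"
  shows "(\<lambda>z. \<chi> j. val (z $ j)) ` S =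
    (\<lambda>x. \<chi> j. ereal (x $ j)) `
      {x :: real ^ 'n. \<forall>i\<in>{1..m}.
         trop_plus (formal_trop (P i)) x \<ge> trop_minus (formal_trop (P i)) x}"
proof -
  define T where "T = {x. \<forall>i\<in>{1..m}. \<exists>\<alpha>\<in>Argmax (formal_trop (P i)) x.
    0 < Poly_Mapping.lookup (P i) \<alpha>}"
  have T_trop: "{x. \<forall>i\<in>{1..m}. trop_plus (formal_trop (P i)) x \<ge> trop_minus (formal_trop (P i)) x} = T"
    unfolding T_def using assms(1) by (auto simp: trop_minus_le_plus_iff)
  have "complex_support (complexes_ge m (\<lambda>i. formal_trop (P i))) = T"
    unfolding complex_support_complexes_ge Union_complex_ge T_def by auto
  with assms(4) have reg: "regular_set T" by simp
  have val: "val w = ereal (lexp w)" if "0 < w" for w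
    using that by (auto simp: val_def)
  have "(\<lambda>z. \<chi> j. val (z $ j)) ` S \<subseteq> (\<lambda>x. \<chi> j. ereal (x $ j)) ` T"
  proof clarify
    fix z assume "z \<in> S"
    then have z: "0 < z $ j" and "i \<in> {1..m} \<Longrightarrow> box i (mpoly_eval (P i) z) 0" for i j
      using assms(3) by auto
    then have "0 \<le> mpoly_eval (P i) z" if "i \<in> {1..m}" for i
      using that assms(2) by force
    then have "(\<chi> j. lexp (z $ j)) \<in> T"
      unfolding T_def using assms(1) z by (auto intro!: positive_Argmax_of_nonneg)
    moreover have "(\<chi> j. val (z $ j)) = (\<chi> j. ereal ((\<chi> j. lexp (z $ j)) $ j))"
      using z by (simp add: val)
    ultimately show "(\<chi> j. val (z $ j)) \<in> (\<lambda>x. \<chi> j. ereal (x $ j)) ` T" by blast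
  qed
  moreover have "(\<lambda>x. \<chi> j. ereal (x $ j)) ` T \<subseteq> (\<lambda>z. \<chi> j. val (z $ j)) ` S"
  proof clarify
    fix x assume x: "x \<in> T"
    have "\<forall>\<^sub>F y in nhds x. \<forall>i\<in>{1..m}. Argmax (formal_trop (P i)) y \<subseteq> Argmax (formal_trop (P i)) x"
      using assms(1) by (intro eventually_ball_finite ballI Argmax_semicontinuous) auto
    then obtain U where U: "open U" "x \<in> U"
      "\<And>y i. y \<in> U \<Longrightarrow> i \<in> {1..m} \<Longrightarrow> Argmax (formal_trop (P i)) y \<subseteq> Argmax (formal_trop (P i)) x"
      unfolding eventually_nhds by metis
    obtain y where y: "y \<in> U" "\<forall>i\<in>{1..m}. \<exists>\<alpha>. Argmax (formal_trop (P i)) y = {\<alpha>}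
        \<and> 0 < Poly_Mapping.lookup (P i) \<alpha>"
      using generic_point_near[OF _ T_def reg x U(1,2)] by auto
    \<comment> \<open>At \<open>x\<close> the maximal terms are equal, at \<open>y\<close> one of them wins: the difference of their slopes
      along \<open>y - x\<close> is the gap at \<open>y\<close>.\<close>
    define u where "u = y - x"
    have "\<forall>\<^sub>F c in at_top. 0 < mpoly_eval (P i) (\<chi> j. pmonom (c powr (u $ j)) (x $ j))"
      if i: "i \<in> {1..m}" for i
    proof -
      obtain k where k: "Argmax (formal_trop (P i)) y = {k}" "0 < Poly_Mapping.lookup (P i) k"
        using y(2) i by blast
      have kx: "k \<in> Argmax (formal_trop (P i)) x" using U(3)[OF y(1) i] k(1) by blast
      show ?thesis
      proof (rule lift_generic_direction[OF kx k(2)])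
        fix \<beta> assume \<beta>: "\<beta> \<in> Argmax (formal_trop (P i)) x" "\<beta> \<noteq> k"
        have "term_exp (P i) \<beta> x = term_exp (P i) k x"
          using \<beta>(1) kx by (auto simp: Argmax_formal_trop intro: antisym)
        moreover have "term_exp (P i) \<beta> y < term_exp (P i) k y"
        proof (rule ccontr)
          assume "\<not> ?thesis"
          moreover have "k \<in> Argmax (formal_trop (P i)) y" using k(1) by simp
          ultimately have "\<beta> \<in> Argmax (formal_trop (P i)) y"
            using \<beta>(1) unfolding Argmax_formal_trop by force
          with k(1) \<beta>(2) show False by simp
        qed
        ultimately show "(\<chi> j. real (\<beta> $ j)) \<bullet> u < (\<chi> j. real (k $ j)) \<bullet> u"
          by (simp add: term_exp_def u_def inner_diff_right)
      qed
    qed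
    then have "\<forall>\<^sub>F c in at_top. \<forall>i\<in>{1..m}.
        0 < mpoly_eval (P i) (\<chi> j. pmonom (c powr (u $ j)) (x $ j))"
      by (intro eventually_ball_finite) auto
    then have "\<forall>\<^sub>F c in at_top. (\<forall>i\<in>{1..m}.
        0 < mpoly_eval (P i) (\<chi> j. pmonom (c powr (u $ j)) (x $ j))) \<and> (0::real) < c"
      using eventually_gt_at_top[of 0] by (rule eventually_conj)
    then obtain c :: real where c: "0 < c"
      "\<And>i. i \<in> {1..m} \<Longrightarrow> 0 < mpoly_eval (P i) (\<chi> j. pmonom (c powr (u $ j)) (x $ j))"
      using eventually_happens'[OF trivial_limit_at_top_linorder] by blast
    define z where "z = (\<chi> j. pmonom (c powr (u $ j)) (x $ j))"
    have pos: "0 < z $ j" for j using c(1) by (simp add: z_def flip: lc_pos_iff)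
    have "box i (mpoly_eval (P i) z) 0" if "i \<in> {1..m}" for i
      using c(2)[OF that] assms(2) that by (force simp: z_def)
    with pos have "z \<in> S" using assms(3) by blast
    moreover have "(\<chi> j. ereal (x $ j)) = (\<chi> j. val (z $ j))"
      using c(1) by (simp add: val[OF pos]) (simp add: z_def lexp_pmonom)
    ultimately show "(\<chi> j. ereal (x $ j)) \<in> (\<lambda>z. \<chi> j. val (z $ j)) ` S" by blast
  qed
  ultimately show ?thesis unfolding T_trop by (rule subset_antisym)
qed

end
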